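(* For any finite, connected, undirected graph $G=(V,E)$ with $|V|\ge 2$, there exists a parallel chip-firing game on $G$ with period $T=2$.
   Context: A parallel chip-firing game on an undirected graph $G$ starts with a finite nonnegative integer number of chips on each vertex. In each round, simultaneously, every vertex having at least as many chips as neighbors fires, sending one chip to each of its neighbors; all other vertices wait. The game has period $T$ if $T$ is the smallest positive integer for which there is a round $t_0$ such that every vertex has the same number of chips in round $t$ as in round $t+T$ for all $t\ge t_0$. *)

theory Defs
  imports "Graph_Theory.Digraph_Component"
begin

text \<open>
  Finite undirected graphs are simple graphs in the sense of the locale \<^locale>\<open>graph\<close>: finite,
  loop-free, without parallel arcs, and symmetric, so that each undirected edge is represented
  by its two orientations.
\<close>

definition neighbors :: "('a, 'b) pre_digraph \<Rightarrow> 'a \<Rightarrow> 'a set" where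
  "neighbors G v = {u. v \<rightarrow>\<^bsub>G\<^esub> u}"

text \<open>
  A chip configuration is a function \<^typ>\<open>'a \<Rightarrow> nat\<close>; only its values on \<^term>\<open>verts G\<close> matter.
\<close>

definition fires :: "('a, 'b) pre_digraph \<Rightarrow> ('a \<Rightarrow> nat) \<Rightarrow> 'a \<Rightarrow> bool" where
  "fires G c v \<longleftrightarrow> card (neighbors G v) \<le> c v"

text \<open>
  The subtraction of naturals below never truncates, by the definition of \<^const>\<open>fires\<close>.
\<close>

definition fire_round :: "('a, 'b) pre_digraph \<Rightarrow> ('a \<Rightarrow> nat) \<Rightarrow> 'a \<Rightarrow> nat" where
  "fire_round G c v =
     (if fires G c v then c v - card (neighbors G v) else c v)
     + card {u \<in> neighbors G v. fires G c u}"

text \<open>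
  The game is deterministic, hence given by its initial configuration.
\<close>

definition chips :: "('a, 'b) pre_digraph \<Rightarrow> ('a \<Rightarrow> nat) \<Rightarrow> nat \<Rightarrow> 'a \<Rightarrow> nat" where
  "chips G c t = (fire_round G ^^ t) c"

definition eventually_repeats :: "('a, 'b) pre_digraph \<Rightarrow> ('a \<Rightarrow> nat) \<Rightarrow> nat \<Rightarrow> bool" where
  "eventually_repeats G c T \<longleftrightarrow>
     (\<exists>t0. \<forall>t\<ge>t0. \<forall>v\<in>verts G. chips G c t v = chips G c (t + T) v)"

definition has_period :: "('a, 'b) pre_digraph \<Rightarrow> ('a \<Rightarrow> nat) \<Rightarrow> nat \<Rightarrow> bool" where
  "has_period G c T \<longleftrightarrow>
     0 < T \<and> eventually_repeats G c T \<and> (\<forall>T'>0. eventually_repeats G c T' \<longrightarrow> T \<le> T')"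

end

theory Submission
  imports Defs
begin

text \<open>
  Let \<open>A\<close> be a maximal independent set. Since no vertex is isolated, every vertex of \<open>A\<close> has a
  neighbor outside \<open>A\<close>, and by maximality every vertex outside \<open>A\<close> has a neighbor in \<open>A\<close>. Placing
  \<open>deg v\<close> chips on each \<open>v \<in> A\<close>, and on every other vertex as many chips as it has neighbors
  outside \<open>A\<close>, makes \<open>A\<close> and its complement fire alternately.
\<close>

context graph
begin

lemma neighbors_subset_verts: "neighbors G v \<subseteq> verts G"
  by (auto simp: neighbors_def dest: adj_in_verts)

lemma finite_neighbors: "finite (neighbors G v)"
  using neighbors_subset_verts finite_verts by (rule finite_subset)

lemma neighbors_outside_verts: "v \<notin> verts G \<Longrightarrow> neighbors G v = {}"
  by (auto simp: neighbors_def dest: adj_in_verts)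

lemma neighbors_sym: "u \<in> neighbors G v \<longleftrightarrow> v \<in> neighbors G u"
  by (auto simp: neighbors_def intro: graph_symmetric)

lemma not_in_own_neighbors: "v \<notin> neighbors G v"
  by (auto simp: neighbors_def dest: adj_not_same)

text \<open>Symmetry of the arcs turns connectedness into strong connectedness, so a directed path
  leads from \<open>v\<close> to some second vertex; its first arc gives a neighbor.\<close>

lemma connected_imp_neighbors_nonempty:
  assumes conn: "connected G" and card: "2 \<le> card (verts G)" and v: "v \<in> verts G"
  shows "neighbors G v \<noteq> {}"
proof -
  have "verts G \<noteq> {v}"
    using card by auto
  with v obtain w where w: "w \<in> verts G" "w \<noteq> v"
    by auto
  have "v \<rightarrow>\<^sup>* w"
    using symmetric_connected_imp_strongly_connected[OF sym_arcs conn] v w by auto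
  then obtain u where "v \<rightarrow> u"
    using w by (auto elim: converse_reachable_cases)
  then show ?thesis
    by (auto simp: neighbors_def)
qed

text \<open>The independent sets form a finite family containing the empty set, so one is maximal
  under inclusion. A vertex outside it without neighbors in it could be added, as adjacency is
  symmetric and loop-free.\<close>

lemma maximal_independent_set_exists:
  obtains A where "A \<subseteq> verts G" "\<And>v. v \<in> A \<Longrightarrow> neighbors G v \<inter> A = {}"
    "\<And>v. v \<in> verts G \<Longrightarrow> v \<notin> A \<Longrightarrow> neighbors G v \<inter> A \<noteq> {}"
proof -
  let ?I = "{A. A \<subseteq> verts G \<and> (\<forall>v\<in>A. neighbors G v \<inter> A = {})}"
  have "finite ?I"
    using finite_verts by (auto intro: finite_subset[of _ "Pow (verts G)"])
  moreover have "{} \<in> ?I"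
    by simp
  ultimately obtain A where A: "A \<in> ?I" and max: "\<And>B. B \<in> ?I \<Longrightarrow> A \<subseteq> B \<Longrightarrow> A = B"
    by (metis (no_types, lifting) empty_iff finite_has_maximal)
  have "neighbors G v \<inter> A \<noteq> {}" if "v \<in> verts G" "v \<notin> A" for v
  proof
    assume disj: "neighbors G v \<inter> A = {}"
    have "neighbors G u \<inter> insert v A = {}" if "u \<in> insert v A" for u
      using that A disj neighbors_sym[of v u] not_in_own_neighbors[of v] by auto
    with that A have "insert v A \<in> ?I"
      by auto
    from max[OF this] \<open>v \<notin> A\<close> show False
      by blast
  qed
  with A that show thesis
    by blast
qed

end

lemma chips_add: "chips G c (s + t) = chips G (chips G c t) s"
  by (simp add: chips_def funpow_add)

text \<open>The game alternates between \<open>c\<close> and \<open>c'\<close>, and their difference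
  at \<open>v\<close> excludes period 1.\<close>

lemma has_period_2I:
  assumes swap: "fire_round G c = c'" "fire_round G c' = c"
    and diff: "v \<in> verts G" "c v \<noteq> c' v"
  shows "has_period G c 2"
proof -
  have two: "chips G c 2 = c"
    using swap by (simp add: chips_def numeral_2_eq_2)
  have even: "chips G c (2 * n) = c" for n
  proof (induction n)
    case (Suc n)
    have "chips G c (2 * Suc n) = chips G (chips G c 2) (2 * n)"
      by (simp flip: chips_add)
    with Suc two show ?case
      by simp
  qed (simp add: chips_def)
  have odd: "chips G c (2 * n + 1) = c'" for n
    using chips_add[of G c 1 "2 * n"] even[of n] swap by (simp add: chips_def)
  have "eventually_repeats G c 2"
    using chips_add[of G c _ 2] by (simp add: eventually_repeats_def two)
  moreover have "\<not> eventually_repeats G c 1"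
  proof
    assume "eventually_repeats G c 1"
    then obtain t0 where "\<And>t. t \<ge> t0 \<Longrightarrow> chips G c t v = chips G c (t + 1) v"
      using diff by (auto simp: eventually_repeats_def)
    \<comment> \<open>\<open>2 * t0\<close> is an even round not before \<open>t0\<close>, so the
      two sides are \<open>c v\<close> and \<open>c' v\<close>.\<close>
    from this[of "2 * t0"] have "chips G c (2 * t0) v = chips G c (2 * t0 + 1) v"
      by simp
    with diff show False
      by (simp only: even odd)
  qed
  ultimately show ?thesis
    unfolding has_period_def by (metis One_nat_def Suc_1 Suc_leI le_neq_implies_less zero_less_numeral)
qed

theorem lemmaA1:
  fixes G :: "('a, 'b) pre_digraph"
  assumes "graph G"
    and "Digraph_Component.connected G"
    and "2 \<le> card (verts G)"
  shows "\<exists>c :: 'a \<Rightarrow> nat. has_period G c 2"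
proof -
  interpret graph G by fact
  let ?N = "neighbors G"
  obtain A where A: "A \<subseteq> verts G" and indep: "\<And>v. v \<in> A \<Longrightarrow> ?N v \<inter> A = {}"
    and dom: "\<And>v. v \<in> verts G \<Longrightarrow> v \<notin> A \<Longrightarrow> ?N v \<inter> A \<noteq> {}"
    using maximal_independent_set_exists by blast
  have pos: "0 < card (?N v)" if "v \<in> verts G" for v
    using connected_imp_neighbors_nonempty[OF assms(2,3) that] finite_neighbors
    by (simp add: card_gt_0_iff)
  define c where "c v = (if v \<in> A then card (?N v) else card (?N v - A))" for v
  define c' where "c' v = (if v \<in> A then 0 else card (?N v))" for v
  \<comment> \<open>The restriction to \<open>verts G\<close> matters: a vertex outside the graph
    has degree 0 and 0 chips, so it counts as firing without lying in \<open>A\<close>.\<close>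
  have fires_c: "fires G c v \<longleftrightarrow> v \<in> A" if "v \<in> verts G" for v
  proof (cases "v \<in> A")
    case False
    have "card (?N v - A) < card (?N v)"
      using dom[OF that False] finite_neighbors by (intro psubset_card_mono) auto
    with False show ?thesis
      by (simp add: fires_def c_def)
  qed (simp add: fires_def c_def)
  have fires_c': "fires G c' v \<longleftrightarrow> v \<notin> A" for v
    using pos A by (fastforce simp: fires_def c'_def)
  have firing_c: "{u \<in> ?N v. fires G c u} = ?N v \<inter> A" for v
    using fires_c neighbors_subset_verts by blast
  have firing_c': "{u \<in> ?N v. fires G c' u} = ?N v - A" for v
    using fires_c' by blast
  have "fire_round G c v = c' v" for v
  proof (cases "v \<in> verts G")
    case True
    \<comment> \<open>For \<open>v\<close> outside \<open>A\<close>, the chips received from its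
      neighbors in \<open>A\<close> raise its count exactly to its degree.\<close>
    have "card (?N v - A) + card (?N v \<inter> A) = card (?N v)"
      using card_Int_Diff[OF finite_neighbors, of v A] by simp
    with indep[of v] fires_c[OF True] show ?thesis
      unfolding fire_round_def firing_c by (simp add: c_def c'_def)
  next
    case False
    with A show ?thesis
      by (auto simp: fire_round_def c_def c'_def neighbors_outside_verts)
  qed
  \<comment> \<open>By independence, a vertex of \<open>A\<close> has all its neighbors outside
    \<open>A\<close> and so regains its full degree.\<close>
  moreover have "fire_round G c' v = c v" for v
    using indep[of v] unfolding fire_round_def firing_c'
    by (auto simp: fires_c' c_def c'_def Diff_triv)
  \<comment> \<open>Were \<open>A\<close> empty, no vertex could have a neighbor in it,
    contradicting \<open>dom\<close>.\<close>
  moreover obtain a where "a \<in> A"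
    using dom assms(3) by fastforce
  then have "a \<in> verts G" "c a \<noteq> c' a"
    using A pos by (auto simp: c_def c'_def)
  ultimately show ?thesis
    by (blast intro: has_period_2I)
qed

end
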